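(* Let $\mathcal Q(C_a,C_b)$ be a hypergraph product code with the logical Pauli operators given by SLT bases. For every logical qubit $(i,h,L)$ of the left sector, the single-qubit targeted logical Phase gate acting on the $(i,h,L)$-th logical qubit has the symplectic representation $$F^S_{i,h,L}=\begin{bmatrix} I_{\tilde n}&0&\tilde B&0\\ 0&I_{\tilde m}&0&0\\ 0&0&I_{\tilde n}&0\\ 0&0&0&I_{\tilde m}\end{bmatrix},\qquad \tilde B=(a_i\otimes e_h)^{\top}(a_i\otimes e_h),$$ where the row and column blocks have sizes $\tilde n,\tilde m,\tilde n,\tilde m$.
   Context: All vectors are row vectors over $\mathbb F_2$; $e_i$ denotes a standard basis vector of the appropriate length. Given binary matrices $H_a$ ($m_a\times n_a$) and $H_b$ ($m_b\times n_b$), parity-check matrices of classical codes $C_a=\ker H_a$, $C_b=\ker H_b$, the hypergraph product (HGP) code $\mathcal Q(C_a,C_b)$ is the CSS code on $n=\tilde n+\tilde m$ qubits, $\tilde n=n_an_b$, $\tilde m=m_am_b$, with $$H_X=[H_a\otimes I_{n_b}\,|\,I_{m_a}\otimes H_b^{\top}],\qquad H_Z=[I_{n_a}\otimes H_b\,|\,H_a^{\top}\otimes I_{m_b}].$$ The first $\tilde n$ qubits form the left sector, the last $\tilde m$ the right sector. Stabilizer generators correspond to the vectors $[H_X(r,:),0]$, $[0,H_Z(r,:)]$ in $\mathbb F_2^{2n}$, where $[a,b]$ represents up to phase the Pauli operator $X^{a_1}Z^{b_1}\otimes\cdots\otimes X^{a_n}Z^{b_n}$. An SLT basis of a subspace is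 a basis $\{a_i\}$ whose vectors are indexed by distinct coordinates $i$ (pivots) such that $(a_i)_i=1$ and $(a_{i'})_i=0$ for pivots $i'\ne i$. Let $\{a_i\},\{\alpha_j\},\{b_h\},\{\beta_l\}$ be SLT bases of $\ker H_a,\ker H_a^{\top},\ker H_b,\ker H_b^{\top}$. Logical qubits are labelled $(i,h,L)$ ($i$ a pivot of $\{a_i\}$, $h$ a pivot of $\{b_h\}$) and $(j,l,R)$ ($j$ a pivot of $\{\alpha_j\}$, $l$ a pivot of $\{\beta_l\}$). Logical Paulis: $\overline X_{i,h,L}$ is the $X$-type operator with vector $[\,e_i\otimes b_h\,|\,0\,]$, $\overline Z_{i,h,L}$ the $Z$-type operator with vector $[\,a_i\otimes e_h\,|\,0\,]$, $\overline X_{j,l,R}$ the $X$-type operator with vector $[\,0\,|\,\alpha_j\otimes e_l\,]$, $\overline Z_{j,l,R}$ the $Z$-type operator with vector $[\,0\,|\,e_j\otimes\beta_l\,]$. A matrix $F$ is a symplectic representation of a logical gate $g$ if $F\Omega F^{\top}=\Omega$ with $\Omega=\begin{bmatrix}0 & I_n \\ I_n & 0\end{bmatrix}$, right multiplication by $F$ fixes every stabilizer generator vector, and it maps the vectors in $\mathbb F_2^{2n}$ of the logical Paulis as $g$ prescribes modulo phases. The logical Phase gate on $(i,h,L)$ maps $\overline X_{i,h,L}\mapsto\overline X_{i,h,L}\overline Z_{i,h,L}$ and fixes all other logical Paulis $\overline X,\overline Z$. *)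

theory Defs
  imports "Jordan_Normal_Form.Matrix_Kernel" "HOL-Library.Z2"
begin

text \<open>
  Binary matrices and vectors are the \<open>bit mat\<close> and \<open>bit vec\<close> of Jordan normal form;
  coordinates, rows and columns are numbered from 0. Vectors are read as row vectors:
  \<open>mat_of_row v * F\<close> is the vector-matrix product \<open>v F\<close>.
\<close>

subsection \<open>Kronecker products\<close>

definition kron_mat :: "'a::semiring_0 mat \<Rightarrow> 'a mat \<Rightarrow> 'a mat" (infixl \<open>\<otimes>\<^sub>m\<close> 70) where
  "A \<otimes>\<^sub>m B = mat (dim_row A * dim_row B) (dim_col A * dim_col B)
     (\<lambda>(r, c). A $$ (r div dim_row B, c div dim_col B) * B $$ (r mod dim_row B, c mod dim_col B))"

definition kron_vec :: "'a::semiring_0 vec \<Rightarrow> 'a vec \<Rightarrow> 'a vec" (infixl \<open>\<otimes>\<^sub>v\<close> 70) where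
  "u \<otimes>\<^sub>v v = vec (dim_vec u * dim_vec v) (\<lambda>k. u $ (k div dim_vec v) * v $ (k mod dim_vec v))"

definition append_cols :: "'a::zero mat \<Rightarrow> 'a mat \<Rightarrow> 'a mat" where
  "append_cols A B = four_block_mat A B (0\<^sub>m 0 (dim_col A)) (0\<^sub>m 0 (dim_col B))"

subsection \<open>Hypergraph product codes\<close>

definition hgp_length :: "bit mat \<Rightarrow> bit mat \<Rightarrow> nat" where
  "hgp_length Ha Hb = dim_col Ha * dim_col Hb + dim_row Ha * dim_row Hb"

definition hgp_HX :: "bit mat \<Rightarrow> bit mat \<Rightarrow> bit mat" where
  "hgp_HX Ha Hb = append_cols (Ha \<otimes>\<^sub>m 1\<^sub>m (dim_col Hb)) (1\<^sub>m (dim_row Ha) \<otimes>\<^sub>m transpose_mat Hb)"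

definition hgp_HZ :: "bit mat \<Rightarrow> bit mat \<Rightarrow> bit mat" where
  "hgp_HZ Ha Hb = append_cols (1\<^sub>m (dim_col Ha) \<otimes>\<^sub>m Hb) (transpose_mat Ha \<otimes>\<^sub>m 1\<^sub>m (dim_row Hb))"

text \<open>
  \<open>[x, z] = x @\<^sub>v z\<close> with \<open>x\<close>, \<open>z\<close> of length \<open>n\<close> represents, up to phase, the Pauli operator
  \<open>X^(x 0) Z^(z 0) \<otimes> ... \<otimes> X^(x (n-1)) Z^(z (n-1))\<close>. Products of Pauli operators correspond
  to sums of vectors.
\<close>

definition X_type :: "bit vec \<Rightarrow> bit vec" where
  "X_type x = x @\<^sub>v 0\<^sub>v (dim_vec x)"

definition Z_type :: "bit vec \<Rightarrow> bit vec" where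
  "Z_type z = 0\<^sub>v (dim_vec z) @\<^sub>v z"

definition hgp_stabilizers :: "bit mat \<Rightarrow> bit mat \<Rightarrow> bit vec set" where
  "hgp_stabilizers Ha Hb =
     {X_type (row (hgp_HX Ha Hb) r) | r. r < dim_row (hgp_HX Ha Hb)} \<union>
     {Z_type (row (hgp_HZ Ha Hb) r) | r. r < dim_row (hgp_HZ Ha Hb)}"

subsection \<open>SLT bases\<close>

text \<open>
  \<open>slt_basis n W P v\<close>: the family \<open>(v i)\<close>, \<open>i \<in> P\<close>, is an SLT basis of the subspace \<open>W\<close>
  of the vectors of length \<open>n\<close>, with set of pivots \<open>P\<close>. The values of \<open>v\<close> outside \<open>P\<close> are
  irrelevant, and the last condition makes \<open>v\<close> injective on \<open>P\<close>.
\<close>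

definition slt_basis :: "nat \<Rightarrow> bit vec set \<Rightarrow> nat set \<Rightarrow> (nat \<Rightarrow> bit vec) \<Rightarrow> bool" where
  "slt_basis n W P v \<longleftrightarrow>
     P \<subseteq> {..<n} \<and>
     vectorspace.basis class_ring ((module_vec TYPE(bit) n)\<lparr>carrier := W\<rparr>) (v ` P) \<and>
     (\<forall>i\<in>P. v i $ i = 1 \<and> (\<forall>i'\<in>P. i' \<noteq> i \<longrightarrow> v i $ i' = 0))"

subsection \<open>Logical qubits, logical Pauli operators and logical gates\<close>

text \<open>\<open>LeftQ i h\<close> is \<open>(i, h, L)\<close> and \<open>RightQ j l\<close> is \<open>(j, l, R)\<close>.\<close>

datatype hgp_qubit = LeftQ nat nat | RightQ nat nat

datatype 'q logical_pauli = LX 'q | LZ 'q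

definition hgp_qubits :: "nat set \<Rightarrow> nat set \<Rightarrow> nat set \<Rightarrow> nat set \<Rightarrow> hgp_qubit set" where
  "hgp_qubits Pa P\<alpha> Pb P\<beta> =
     {LeftQ i h | i h. i \<in> Pa \<and> h \<in> Pb} \<union> {RightQ j l | j l. j \<in> P\<alpha> \<and> l \<in> P\<beta>}"

fun hgp_logical_vec ::
  "bit mat \<Rightarrow> bit mat \<Rightarrow> (nat \<Rightarrow> bit vec) \<Rightarrow> (nat \<Rightarrow> bit vec) \<Rightarrow> (nat \<Rightarrow> bit vec) \<Rightarrow>
   (nat \<Rightarrow> bit vec) \<Rightarrow> hgp_qubit logical_pauli \<Rightarrow> bit vec" where
  "hgp_logical_vec Ha Hb a \<alpha> b \<beta> (LX (LeftQ i h)) =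
     X_type ((unit_vec (dim_col Ha) i \<otimes>\<^sub>v b h) @\<^sub>v 0\<^sub>v (dim_row Ha * dim_row Hb))"
| "hgp_logical_vec Ha Hb a \<alpha> b \<beta> (LZ (LeftQ i h)) =
     Z_type ((a i \<otimes>\<^sub>v unit_vec (dim_col Hb) h) @\<^sub>v 0\<^sub>v (dim_row Ha * dim_row Hb))"
| "hgp_logical_vec Ha Hb a \<alpha> b \<beta> (LX (RightQ j l)) =
     X_type (0\<^sub>v (dim_col Ha * dim_col Hb) @\<^sub>v (\<alpha> j \<otimes>\<^sub>v unit_vec (dim_row Hb) l))"
| "hgp_logical_vec Ha Hb a \<alpha> b \<beta> (LZ (RightQ j l)) =
     Z_type (0\<^sub>v (dim_col Ha * dim_col Hb) @\<^sub>v (unit_vec (dim_row Ha) j \<otimes>\<^sub>v \<beta> l))"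

text \<open>
  A logical gate is given, modulo phases, by its action on the logical Paulis: each
  \<open>p\<close> is mapped to the product of the list of logical Paulis \<open>g p\<close>.
\<close>

type_synonym 'q logical_gate = "'q logical_pauli \<Rightarrow> 'q logical_pauli list"

definition phase_gate :: "'q \<Rightarrow> 'q logical_gate" where
  "phase_gate q p = (if p = LX q then [LX q, LZ q] else [p])"

definition symplectic_form :: "nat \<Rightarrow> bit mat" where
  "symplectic_form n = four_block_mat (0\<^sub>m n n) (1\<^sub>m n) (1\<^sub>m n) (0\<^sub>m n n)"

text \<open>
  Symplectic representation \<open>F\<close> of a logical gate \<open>g\<close> on a stabilizer code with \<open>n\<close> physical
  qubits, stabilizer generator vectors \<open>S\<close>, logical qubits \<open>Q\<close> and vectors \<open>lv p\<close> of
  the logical Paulis.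
\<close>

definition symplectic_rep ::
  "nat \<Rightarrow> bit vec set \<Rightarrow> 'q set \<Rightarrow> ('q logical_pauli \<Rightarrow> bit vec) \<Rightarrow> 'q logical_gate \<Rightarrow> bit mat \<Rightarrow> bool"
where
  "symplectic_rep n S Q lv g F \<longleftrightarrow>
     F \<in> carrier_mat (2 * n) (2 * n) \<and>
     F * symplectic_form n * transpose_mat F = symplectic_form n \<and>
     (\<forall>s\<in>S. mat_of_row s * F = mat_of_row s) \<and>
     (\<forall>p \<in> LX ` Q \<union> LZ ` Q.
        mat_of_row (lv p) * F = mat_of_row (foldr (+) (map lv (g p)) (0\<^sub>v (2 * n))))"

subsection \<open>The matrix of the left-sector Phase gate\<close>

definition phase_block :: "nat \<Rightarrow> nat \<Rightarrow> bit mat \<Rightarrow> bit mat" where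
  "phase_block n m B =
     four_block_mat
       (four_block_mat (1\<^sub>m n) (0\<^sub>m n m)
                       (0\<^sub>m m n) (1\<^sub>m m))
       (four_block_mat B         (0\<^sub>m n m)
                       (0\<^sub>m m n) (0\<^sub>m m m))
       (four_block_mat (0\<^sub>m n n) (0\<^sub>m n m)
                       (0\<^sub>m m n) (0\<^sub>m m m))
       (four_block_mat (1\<^sub>m n) (0\<^sub>m n m)
                       (0\<^sub>m m n) (1\<^sub>m m))"

end

theory Submission
  imports Defs
begin

text \<open>
  With \<open>w = [a\<^sub>i \<otimes> e\<^sub>h | 0]\<close> the matrix is the symplectic transvection
  \<open>[x, z] \<mapsto> [x, z + (x \<bullet> w) w]\<close>. Vectors of \<open>Z\<close>-type are fixed. A row of \<open>H\<^sub>X\<close> is fixed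
  because \<open>a\<^sub>i\<close> lies in the kernel of \<open>H\<^sub>a\<close>, and an \<open>X\<close>-type logical operator is changed exactly
  when its scalar product with \<open>w\<close> is 1; by the SLT property this happens only for the logical
  qubit \<open>(i, h, L)\<close>, where the change is the addition of the logical \<open>Z\<close> operator \<open>[0, w]\<close>.
\<close>

section \<open>Kronecker products and rows of block matrices\<close>

lemma dim_kron_vec [simp]: "dim_vec (u \<otimes>\<^sub>v v) = dim_vec u * dim_vec v"
  by (simp add: kron_vec_def)

lemma dim_kron_mat [simp]:
  "dim_row (A \<otimes>\<^sub>m B) = dim_row A * dim_row B" "dim_col (A \<otimes>\<^sub>m B) = dim_col A * dim_col B"
  by (simp_all add: kron_mat_def)

lemma kron_vec_carrier:
  "u \<in> carrier_vec n \<Longrightarrow> v \<in> carrier_vec m \<Longrightarrow> u \<otimes>\<^sub>v v \<in> carrier_vec (n * m)"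
  by (rule carrier_vecI) simp

text \<open>Division with remainder by \<open>dim_vec v'\<close> turns the index \<open>k\<close>
  into a pair \<open>(p, q)\<close>, and the sum over pairs splits into a product of two sums.
  Scalar products with \<open>a i \<otimes>\<^sub>v unit_vec nb h\<close> can then be evaluated
  factor by factor.\<close>

lemma scalar_prod_kron_vec:
  fixes u v :: "'a::comm_semiring_0 vec"
  assumes "dim_vec u = dim_vec u'" and "dim_vec v = dim_vec v'"
  shows "(u \<otimes>\<^sub>v v) \<bullet> (u' \<otimes>\<^sub>v v') = (u \<bullet> u') * (v \<bullet> v')"
proof -
  let ?n = "dim_vec u'" and ?m = "dim_vec v'"
  have "(u \<otimes>\<^sub>v v) \<bullet> (u' \<otimes>\<^sub>v v') =
      (\<Sum>k = 0..<?n * ?m. (u $ (k div ?m) * u' $ (k div ?m)) * (v $ (k mod ?m) * v' $ (k mod ?m)))"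
    unfolding scalar_prod_def
    by (rule sum.cong) (auto simp: kron_vec_def assms ac_simps)
  also have "\<dots> = (\<Sum>(p, q) \<in> {0..<?n} \<times> {0..<?m}. (u $ p * u' $ p) * (v $ q * v' $ q))"
  proof (rule sum.reindex_bij_witness[of _ "\<lambda>(p, q). p * ?m + q" "\<lambda>k. (k div ?m, k mod ?m)"], goal_cases)
    case (2 k)
    then have "0 < ?m" by (cases "?m = 0") auto
    with 2 show ?case by (auto simp: less_mult_imp_div_less)
  next
    case (3 x)
    then have "?m \<noteq> 0" by auto
    with 3 show ?case by auto
  next
    case (4 x)
    then obtain p q where "x = (p, q)" "p < ?n" "q < ?m" by auto
    then have "p * ?m + q < Suc p * ?m" by simp
    also have "\<dots> \<le> ?n * ?m" using \<open>p < ?n\<close> by (intro mult_right_mono) auto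
    finally show ?case using \<open>x = (p, q)\<close> by simp
  qed auto
  also have "\<dots> = (u \<bullet> u') * (v \<bullet> v')"
    by (simp add: scalar_prod_def sum_product sum.cartesian_product)
  finally show ?thesis .
qed

lemma row_kron_mat:
  assumes "r < dim_row A * dim_row B"
  shows "row (A \<otimes>\<^sub>m B) r = row A (r div dim_row B) \<otimes>\<^sub>v row B (r mod dim_row B)"
proof -
  \<comment> \<open>An index below a product forces both factors to be nonzero, so
    \<open>mod\<close> yields legal row and column indices of \<open>B\<close>.\<close>
  have "0 < dim_row B" using assms by (cases "dim_row B = 0") auto
  moreover have "0 < dim_col B" if "k < dim_col A * dim_col B" for k
    using that by (cases "dim_col B = 0") auto
  ultimately show ?thesis
    using assms
    by (intro eq_vecI) (auto simp: kron_mat_def kron_vec_def less_mult_imp_div_less)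
qed

lemma row_append_cols:
  assumes "r < dim_row A" and "dim_row B = dim_row A"
  shows "row (append_cols A B) r = row A r @\<^sub>v row B r"
  unfolding append_cols_def using assms
  by (intro eq_vecI) auto

section \<open>Shear matrices and their symplecticity\<close>

lemma mat_of_row_mult_shear:
  fixes x :: "'a::comm_semiring_1 vec"
  assumes x: "x \<in> carrier_vec n" and z: "z \<in> carrier_vec n" and w: "w \<in> carrier_vec n"
  shows "mat_of_row (x @\<^sub>v z) *
      four_block_mat (1\<^sub>m n) (transpose_mat (mat_of_row w) * mat_of_row w) (0\<^sub>m n n) (1\<^sub>m n) =
    mat_of_row (x @\<^sub>v (z + (x \<bullet> w) \<cdot>\<^sub>v w))" (is "_ * ?F = ?R")
proof (rule eq_matI)
  fix r k assume "r < dim_row ?R" "k < dim_col ?R"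
  then have r: "r = 0" and k: "k < n + n" using x z w by auto
  let ?N = "transpose_mat (mat_of_row w) * mat_of_row w"
  have N: "?N \<in> carrier_mat n n" using w by auto
  show "(mat_of_row (x @\<^sub>v z) * ?F) $$ (r, k) = ?R $$ (r, k)"
  proof (cases "k < n")
    case True
    then have "col ?F k = unit_vec n k @\<^sub>v 0\<^sub>v n"
      using N by (intro eq_vecI) (auto simp: unit_vec_def)
    then show ?thesis using r k True x z w
      by (simp add: scalar_prod_append[of _ n _ n])
  next
    case False
    \<comment> \<open>Column \<open>k - n\<close> of the rank-one block is a multiple of
      \<open>w\<close>, so it contributes \<open>w $ (k - n) * (x \<bullet> w)\<close>; the unit
      vector below it contributes \<open>z $ (k - n)\<close>.\<close>
    then have "col ?F k = w $ (k - n) \<cdot>\<^sub>v w @\<^sub>v unit_vec n (k - n)"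
      using N w k by (intro eq_vecI) (auto simp: unit_vec_def scalar_prod_def mat_of_row_def ac_simps)
    then show ?thesis using r k False x z w
      by (simp add: scalar_prod_append[of _ n _ n] ac_simps)
  qed
qed (use x z w in auto)

text \<open>The product has \<open>N + transpose_mat N\<close> as its upper left block and agrees
  with the form in the other three blocks. Symmetry and characteristic 2 make that block
  vanish.\<close>

lemma shear_symplectic:
  fixes N :: "bit mat"
  assumes N: "N \<in> carrier_mat n n" and sym: "transpose_mat N = N"
  defines "F \<equiv> four_block_mat (1\<^sub>m n) N (0\<^sub>m n n) (1\<^sub>m n)"
  shows "F * symplectic_form n * transpose_mat F = symplectic_form n"
proof -
  have "F * symplectic_form n = four_block_mat N (1\<^sub>m n) (1\<^sub>m n) (0\<^sub>m n n)"
    unfolding F_def symplectic_form_def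
    by (subst mult_four_block_mat[of _ n n _ n _ n _ _ n _ n]) (use N in auto)
  moreover have "transpose_mat F = four_block_mat (1\<^sub>m n) (0\<^sub>m n n) N (1\<^sub>m n)"
    unfolding F_def by (subst transpose_four_block_mat) (use N sym in auto)
  moreover have "N + N = 0\<^sub>m n n" using N by (intro eq_matI) auto
  ultimately show ?thesis
    unfolding symplectic_form_def
    by (simp, subst mult_four_block_mat[of _ n n _ n _ n _ _ n _ n]) (use N in auto)
qed

text \<open>Padding \<open>u\<close> with zeros confines the rank-one matrix of \<open>w\<close> to
  the upper left corner. The two sectors thus merge into one index range of length
  \<open>n + m\<close>, to which the shear lemmas apply.\<close>

lemma phase_block_eq_shear:
  fixes u :: "bit vec" and m :: nat
  assumes u: "u \<in> carrier_vec n"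
  defines "w \<equiv> u @\<^sub>v 0\<^sub>v m"
  shows "phase_block n m (transpose_mat (mat_of_row u) * mat_of_row u) =
    four_block_mat (1\<^sub>m (n + m)) (transpose_mat (mat_of_row w) * mat_of_row w)
      (0\<^sub>m (n + m) (n + m)) (1\<^sub>m (n + m))"
proof -
  have "four_block_mat (transpose_mat (mat_of_row u) * mat_of_row u)
      (0\<^sub>m n m) (0\<^sub>m m n) (0\<^sub>m m m) = transpose_mat (mat_of_row w) * mat_of_row w"
    using u unfolding w_def
    by (intro eq_matI) (auto simp: mat_of_row_def scalar_prod_def)
  then show ?thesis
    unfolding phase_block_def by simp
qed

section \<open>Vectors of X and Z type, and SLT bases of kernels\<close>

lemma X_type_carrier: "x \<in> carrier_vec n \<Longrightarrow> X_type x \<in> carrier_vec (2 * n)"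
  by (rule carrier_vecI) (simp add: X_type_def)

lemma Z_type_carrier: "z \<in> carrier_vec n \<Longrightarrow> Z_type z \<in> carrier_vec (2 * n)"
  by (rule carrier_vecI) (simp add: Z_type_def)

lemma slt_basis_mat_kernel:
  assumes A: "A \<in> carrier_mat m n" and slt: "slt_basis n (mat_kernel A) P v" and "i \<in> P"
  shows "v i \<in> carrier_vec n" and "A *\<^sub>v v i = 0\<^sub>v m"
proof -
  \<comment> \<open>This locale provides the vector space on \<open>mat_kernel A\<close> in which
    \<open>slt_basis\<close> states the basis property.\<close>
  interpret kernel m n A by (unfold_locales) (rule A)
  have "v ` P \<subseteq> mat_kernel A"
    using slt unfolding slt_basis_def Ker.basis_def by blast
  then have "v i \<in> mat_kernel A" using \<open>i \<in> P\<close> by blast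
  then show "v i \<in> carrier_vec n" and "A *\<^sub>v v i = 0\<^sub>v m"
    by (simp_all add: mat_kernel[OF A])
qed

lemma slt_basis_pivot:
  assumes "slt_basis n W P v" and "i \<in> P" and "i' \<in> P"
  shows "v i $ i' = (if i' = i then 1 else 0)"
  using assms by (auto simp: slt_basis_def)

theorem proposition4p3:
  fixes Ha Hb :: "bit mat"
    and ma na mb nb i h :: nat
    and Pa P\<alpha> Pb P\<beta> :: "nat set"
    and a \<alpha> b \<beta> :: "nat \<Rightarrow> bit vec"
  assumes "Ha \<in> carrier_mat ma na" and "Hb \<in> carrier_mat mb nb"
    and "slt_basis na (mat_kernel Ha) Pa a"
    and "slt_basis ma (mat_kernel (transpose_mat Ha)) P\<alpha> \<alpha>"
    and "slt_basis nb (mat_kernel Hb) Pb b"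
    and "slt_basis mb (mat_kernel (transpose_mat Hb)) P\<beta> \<beta>"
    and "LeftQ i h \<in> hgp_qubits Pa P\<alpha> Pb P\<beta>"
  shows "symplectic_rep (hgp_length Ha Hb) (hgp_stabilizers Ha Hb)
           (hgp_qubits Pa P\<alpha> Pb P\<beta>) (hgp_logical_vec Ha Hb a \<alpha> b \<beta>)
           (phase_gate (LeftQ i h))
           (phase_block (na * nb) (ma * mb)
              (transpose_mat (mat_of_row (a i \<otimes>\<^sub>v unit_vec nb h)) *
               mat_of_row (a i \<otimes>\<^sub>v unit_vec nb h)))"
proof -
  let ?n = "na * nb" and ?m = "ma * mb"
  define u where "u = a i \<otimes>\<^sub>v unit_vec nb h"
  define w where "w = u @\<^sub>v 0\<^sub>v ?m"
  define N where "N = transpose_mat (mat_of_row w) * mat_of_row w"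
  define F where "F = phase_block ?n ?m (transpose_mat (mat_of_row u) * mat_of_row u)"
  note Ha = assms(1) and Hb = assms(2) and slt_a = assms(3) and slt_\<alpha> = assms(4)
    and slt_b = assms(5) and slt_\<beta> = assms(6)
  have dims [simp]: "dim_row Ha = ma" "dim_col Ha = na" "dim_row Hb = mb" "dim_col Hb = nb"
    using Ha Hb by auto
  have i: "i \<in> Pa" and h: "h \<in> Pb"
    using assms(7) by (auto simp: hgp_qubits_def)
  \<comment> \<open>Pivots lie in range, so the unit vectors at them are nonzero and a scalar
    product with one reads off a coordinate.\<close>
  have pivot_less: "i' < na" "h' < nb" if "i' \<in> Pa" "h' \<in> Pb" for i' h'
    using slt_a slt_b that by (auto simp: slt_basis_def)
  note a_ker = slt_basis_mat_kernel[OF Ha slt_a] and b_ker = slt_basis_mat_kernel[OF Hb slt_b]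
  have \<alpha>: "\<alpha> j \<in> carrier_vec ma" if "j \<in> P\<alpha>" for j
    using slt_basis_mat_kernel(1)[OF _ slt_\<alpha> that, of na] Ha by auto
  have \<beta>: "\<beta> l \<in> carrier_vec mb" if "l \<in> P\<beta>" for l
    using slt_basis_mat_kernel(1)[OF _ slt_\<beta> that, of nb] Hb by auto
  have u: "u \<in> carrier_vec ?n"
    unfolding u_def using a_ker(1)[OF i] by (intro kron_vec_carrier) auto
  then have w: "w \<in> carrier_vec (?n + ?m)" by (auto simp: w_def)
  have F_shear: "F = four_block_mat (1\<^sub>m (?n + ?m)) N (0\<^sub>m (?n + ?m) (?n + ?m)) (1\<^sub>m (?n + ?m))"
    unfolding F_def N_def w_def using phase_block_eq_shear[OF u] .
  have N: "N \<in> carrier_mat (?n + ?m) (?n + ?m)" using w by (auto simp: N_def)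
  have "transpose_mat N = N"
    unfolding N_def by (subst transpose_mult) (use w in auto)
  note F_symp = shear_symplectic[OF N this, folded F_shear]
  have mult_F: "mat_of_row (x @\<^sub>v z) * F = mat_of_row (x @\<^sub>v (z + (x \<bullet> w) \<cdot>\<^sub>v w))"
    if "x \<in> carrier_vec (?n + ?m)" "z \<in> carrier_vec (?n + ?m)" for x z
    unfolding F_shear N_def using mat_of_row_mult_shear[OF that w] .
  have F_X: "mat_of_row (X_type x) * F = mat_of_row (x @\<^sub>v ((x \<bullet> w) \<cdot>\<^sub>v w))"
    if "x \<in> carrier_vec (?n + ?m)" for x
    using that w mult_F[OF that, of "0\<^sub>v (?n + ?m)"] by (simp add: X_type_def)
  have [simp]: "0 \<cdot>\<^sub>v w = 0\<^sub>v (?n + ?m)"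
    using w by (intro eq_vecI) auto
  have F_X_fixed: "mat_of_row (X_type x) * F = mat_of_row (X_type x)"
    if "x \<in> carrier_vec (?n + ?m)" "x \<bullet> w = 0" for x
    using F_X[OF that(1)] that by (simp add: X_type_def)
  have F_Z_fixed: "mat_of_row (Z_type z) * F = mat_of_row (Z_type z)"
    if "z \<in> carrier_vec (?n + ?m)" for z
    using that w mult_F[OF _ that, of "0\<^sub>v (?n + ?m)"] by (simp add: Z_type_def)
  have HX: "row (hgp_HX Ha Hb) r \<in> carrier_vec (?n + ?m)" "row (hgp_HX Ha Hb) r \<bullet> w = 0"
    if "r < dim_row (hgp_HX Ha Hb)" for r
  proof -
    have r: "r < ma * nb"
      using that by (simp add: hgp_HX_def append_cols_def)
    then have r': "r div nb < ma" "r mod nb < nb"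
      by (cases "nb = 0"; simp add: less_mult_imp_div_less)+
    \<comment> \<open>The identity factor contributes a unit vector, so the left half of the row is
      a single tensor and its scalar product with \<open>u\<close> contains the factor
      \<open>row Ha (r div nb) \<bullet> a i\<close>.\<close>
    have row: "row (hgp_HX Ha Hb) r = (row Ha (r div nb) \<otimes>\<^sub>v unit_vec nb (r mod nb)) @\<^sub>v
        row (1\<^sub>m ma \<otimes>\<^sub>m transpose_mat Hb) r"
      unfolding hgp_HX_def using r r'
      by (simp add: row_append_cols row_kron_mat[of r Ha])
    have right: "row (1\<^sub>m ma \<otimes>\<^sub>m transpose_mat Hb) r \<in> carrier_vec ?m"
      by (rule carrier_vecI) simp
    have left: "row Ha (r div nb) \<otimes>\<^sub>v unit_vec nb (r mod nb) \<in> carrier_vec ?n"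
      using r' Ha by (intro kron_vec_carrier) auto
    show "row (hgp_HX Ha Hb) r \<in> carrier_vec (?n + ?m)"
      using left right by (auto simp: row)
    have "row Ha (r div nb) \<bullet> a i = 0"
      using arg_cong[OF a_ker(2)[OF i], of "\<lambda>v. v $ (r div nb)"] r' by simp
    \<comment> \<open>The right half of the row meets only the zero padding of
      \<open>w\<close>.\<close>
    then show "row (hgp_HX Ha Hb) r \<bullet> w = 0"
      using a_ker(1)[OF i] right u left unfolding row w_def
      by (subst scalar_prod_append[of _ ?n _ ?m]) (auto simp: u_def scalar_prod_kron_vec)
  qed
  have HZ: "row (hgp_HZ Ha Hb) r \<in> carrier_vec (?n + ?m)" for r
    by (rule carrier_vecI) (simp add: hgp_HZ_def append_cols_def)
  have stab: "mat_of_row s * F = mat_of_row s" if "s \<in> hgp_stabilizers Ha Hb" for s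
    using that HX HZ F_X_fixed F_Z_fixed by (auto simp: hgp_stabilizers_def)
  let ?lv = "hgp_logical_vec Ha Hb a \<alpha> b \<beta>" and ?Q = "hgp_qubits Pa P\<alpha> Pb P\<beta>"
  have logical: "mat_of_row (?lv p) * F =
      mat_of_row (foldr (+) (map ?lv (phase_gate (LeftQ i h) p)) (0\<^sub>v (2 * (?n + ?m))))"
    if p: "p \<in> LX ` ?Q \<union> LZ ` ?Q" for p
  proof -
    \<comment> \<open>For every logical Pauli other than the X operator of \<open>(i, h, L)\<close>
      the gate returns \<open>[p]\<close>, and \<open>foldr\<close> merely adds the zero vector. It
      then suffices that \<open>F\<close> fixes the explicit vector \<open>v\<close> of
      \<open>p\<close>.\<close>
    have fixed: ?thesis if "?lv p = v" "v \<in> carrier_vec (2 * (?n + ?m))"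
      "mat_of_row v * F = mat_of_row v" "p \<noteq> LX (LeftQ i h)" for v
      using that right_zero_vec[OF that(2)] by (simp add: phase_gate_def)
    consider (LXL) i' h' where "p = LX (LeftQ i' h')" "i' \<in> Pa" "h' \<in> Pb"
      | (LXR) j l where "p = LX (RightQ j l)" "j \<in> P\<alpha>" "l \<in> P\<beta>"
      | (LZL) i' h' where "p = LZ (LeftQ i' h')" "i' \<in> Pa" "h' \<in> Pb"
      | (LZR) j l where "p = LZ (RightQ j l)" "j \<in> P\<alpha>" "l \<in> P\<beta>"
      using p by (auto simp: hgp_qubits_def)
    then show ?thesis
    proof cases
      case LXL
      let ?x = "(unit_vec na i' \<otimes>\<^sub>v b h') @\<^sub>v 0\<^sub>v ?m"
      have [simp]: "dim_vec (b h') = nb" "dim_vec (a i) = na"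
        using b_ker(1)[OF LXL(3)] a_ker(1)[OF i] by auto
      have left: "unit_vec na i' \<otimes>\<^sub>v b h' \<in> carrier_vec ?n"
        using b_ker(1)[OF LXL(3)] by (intro kron_vec_carrier) auto
      then have x: "?x \<in> carrier_vec (?n + ?m)" by auto
      \<comment> \<open>The two tensor factors are \<open>unit_vec na i' \<bullet> a i\<close> and
        \<open>b h' \<bullet> unit_vec nb h\<close>.\<close>
      have "?x \<bullet> w = a i $ i' * b h' $ h"
        using left u a_ker(1)[OF i] b_ker(1)[OF LXL(3)] pivot_less[OF LXL(2) h] unfolding w_def
        by (subst scalar_prod_append[of _ ?n _ ?m]) (auto simp: u_def scalar_prod_kron_vec)
      \<comment> \<open>Both factors are values of basis vectors at pivots, hence Kronecker
        deltas.\<close>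
      then have x_w: "?x \<bullet> w = (if i' = i \<and> h' = h then 1 else 0)"
        using slt_basis_pivot[OF slt_a i LXL(2)] slt_basis_pivot[OF slt_b LXL(3) h] by auto
      show ?thesis
      proof (cases "i' = i \<and> h' = h")
        case True
        \<comment> \<open>The right side is the image given by \<open>F_X\<close> when the scalar
          product is 1; the left side is the product of the logical X and Z operators.\<close>
        have "X_type ?x + Z_type w = ?x @\<^sub>v w"
          unfolding X_type_def Z_type_def using x w
          by (subst append_vec_add[of _ "?n + ?m" _ _ "?n + ?m"]) auto
        moreover have "Z_type w + 0\<^sub>v (2 * (?n + ?m)) = Z_type w"
          using Z_type_carrier[OF w] by (rule right_zero_vec)
        moreover have "?lv (LX (LeftQ i h)) = X_type ?x" "?lv (LZ (LeftQ i h)) = Z_type w"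
          using True by (simp_all add: w_def u_def)
        ultimately show ?thesis
          using F_X[OF x] x_w True LXL(1) by (simp add: phase_gate_def)
      next
        case False
        then show ?thesis
          using fixed[OF _ X_type_carrier[OF x] F_X_fixed[OF x]] x_w LXL(1) by auto
      qed
    next
      case LXR
      let ?x = "0\<^sub>v ?n @\<^sub>v (\<alpha> j \<otimes>\<^sub>v unit_vec mb l)"
      have right: "\<alpha> j \<otimes>\<^sub>v unit_vec mb l \<in> carrier_vec ?m"
        using \<alpha>[OF LXR(2)] by (intro kron_vec_carrier) auto
      then have x: "?x \<in> carrier_vec (?n + ?m)" by auto
      \<comment> \<open>The supports lie in different sectors.\<close>
      have "?x \<bullet> w = 0" unfolding w_def
        using right u by (subst scalar_prod_append[of _ ?n _ ?m]) auto
      then show ?thesis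
        using fixed[OF _ X_type_carrier[OF x] F_X_fixed[OF x]] LXR(1) by simp
    next
      case LZL
      then have z: "(a i' \<otimes>\<^sub>v unit_vec nb h') @\<^sub>v 0\<^sub>v ?m \<in> carrier_vec (?n + ?m)"
        using a_ker(1) kron_vec_carrier[of "a i'" na "unit_vec nb h'" nb] by auto
      show ?thesis
        using fixed[OF _ Z_type_carrier[OF z] F_Z_fixed[OF z]] LZL(1) by simp
    next
      case LZR
      then have z: "0\<^sub>v ?n @\<^sub>v (unit_vec ma j \<otimes>\<^sub>v \<beta> l) \<in> carrier_vec (?n + ?m)"
        using \<beta> kron_vec_carrier[of "unit_vec ma j" ma "\<beta> l" mb] by auto
      show ?thesis
        using fixed[OF _ Z_type_carrier[OF z] F_Z_fixed[OF z]] LZR(1) by simp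
    qed
  qed
  have "F \<in> carrier_mat (2 * (?n + ?m)) (2 * (?n + ?m))"
    unfolding F_shear mult_2 by (intro four_block_carrier_mat) auto
  with F_symp stab logical show ?thesis
    unfolding symplectic_rep_def hgp_length_def dims u_def[symmetric] F_def[symmetric] by blast
qed

end
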